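(* For binary $z=(z_{ik})$, nonnegative $\mu=(\mu_{km})$ and hub positions $x_k\in\mathbb{R}^d$ ($k\in N$), the set of nonlinear constraints $$\mu_{km}\ge\sum_{(i,j)\in N_{km}}w_{ij}\,\mathrm{d}^H(x_k,x_m)\,z_{ik}z_{jm},\qquad\forall \{k,m\}\in E,$$ is equivalent to the set of inequalities $$\mu_{km}\ge \mathrm{d}^H(x_k,x_m)\sum_{(i,j)\in S}w_{ij}\,(z_{ik}+z_{jm}-1),\qquad\forall S\subseteq N_{km},\ \forall\{k,m\}\in E,$$ where $N_{km}=\{(i,j)\in N\times N:\{i,k\},\{j,m\}\in E\}$; that is, $(z,\mu,x)$ satisfies all constraints of the first family if and only if it satisfies all constraints of the second family.
   Context: $G=(N,E)$ is an undirected graph with node set $N=\{1,\ldots,n\}$ and $E$ a set of unordered pairs of nodes. For $i,j\in N$, $w_{ij}\ge0$ is the demand (flow) from $i$ to $j$. $\mathrm{d}^H:\mathbb{R}^d\times\mathbb{R}^d\to\mathbb{R}_+$ is the inter-hub transportation cost/distance function. The variables are: $z_{ik}\in\{0,1\}$, for ordered $(i,k)$ with $\{i,k\}\in E$, equal to $1$ iff node $i$ is allocated to hub $k$; $x_k\in\mathbb{R}^d$, the position of hub $k$; and $\mu_{km}\ge0$, for ordered $(k,m)$ with $\{k,m\}\in E$, the aggregated flow cost on the inter-hub arc $(k,m)$. Constraints indexed by $\{k,m\}\in E$ are imposed for all ordered pairs $(k,m)$ with $\{k,m\}\in E$. *)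

theory Defs
  imports "HOL-Analysis.Analysis"
begin

text \<open>
  An edge is the set of its two ends, so \<open>{i, k} = {k, i}\<close>. The set \<open>E\<close> may also contain
  loops \<open>{k} = {k, k}\<close>; simple graphs are the special case in which it contains none.
\<close>

definition undirected_graph :: "nat set \<Rightarrow> nat set set \<Rightarrow> bool" where
  "undirected_graph N E \<longleftrightarrow> E \<subseteq> {{i, k} | i k. i \<in> N \<and> k \<in> N}"

definition allocation_pairs :: "nat set \<Rightarrow> nat set set \<Rightarrow> nat \<Rightarrow> nat \<Rightarrow> (nat \<times> nat) set" where
  "allocation_pairs N E k m = {(i, j) \<in> N \<times> N. {i, k} \<in> E \<and> {j, m} \<in> E}"

end

theory Submission
  imports Defs
begin

text \<open>
  The argument treats each arc \<open>(k, m)\<close> separately. For binary \<open>u\<close> and \<open>v\<close> the product \<open>u * v\<close>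
  equals \<open>max 0 (u + v - 1)\<close>. With nonnegative weights, a sum of such positive parts is the
  maximum, over all subsets \<open>S\<close> of the index set, of the corresponding sums of \<open>u + v - 1\<close>: the
  best \<open>S\<close> collects the indices with \<open>u = v = 1\<close>, and every other choice adds nonpositive terms
  or omits nonnegative ones. The right-hand side of an arc's bilinear constraint
  is therefore the largest right-hand side among its linear constraints
  (\<open>bilinear_bound_iff_subset_bounds\<close>), and the nonnegative factor \<open>dH (x k) (x m)\<close>
  preserves this comparison.
\<close>

lemma binary_sum_minus_one_le_product:
  fixes a b :: real
  assumes "a \<in> {0, 1}" "b \<in> {0, 1}"
  shows "a + b - 1 \<le> a * b"
  using assms by auto

text \<open>
  The bilinear sum dominates every linearized sum, because \<open>u + v - 1 \<le> u * v\<close> termwise and the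
  terms omitted by \<open>S\<close> are nonnegative. It is also attained by one of them, namely at the set
  where \<open>u = v = 1\<close>, outside of which the products vanish.
\<close>

lemma bilinear_bound_iff_subset_bounds:
  fixes c u v :: "'a \<Rightarrow> real" and b d :: real
  assumes "finite P" and "0 \<le> d"
    and c: "\<And>p. p \<in> P \<Longrightarrow> 0 \<le> c p"
    and u: "\<And>p. p \<in> P \<Longrightarrow> u p \<in> {0, 1}"
    and v: "\<And>p. p \<in> P \<Longrightarrow> v p \<in> {0, 1}"
  shows "d * (\<Sum>p\<in>P. c p * (u p * v p)) \<le> b
    \<longleftrightarrow> (\<forall>S \<subseteq> P. d * (\<Sum>p\<in>S. c p * (u p + v p - 1)) \<le> b)"
proof (intro iffI allI impI)
  fix S
  assume bilinear: "d * (\<Sum>p\<in>P. c p * (u p * v p)) \<le> b" and "S \<subseteq> P"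
  have nonneg: "0 \<le> c p * (u p * v p)" if "p \<in> P" for p
    using c[OF that] u[OF that] v[OF that] by auto
  have "(\<Sum>p\<in>S. c p * (u p + v p - 1)) \<le> (\<Sum>p\<in>S. c p * (u p * v p))"
  proof (rule sum_mono)
    fix p
    assume "p \<in> S"
    then have "p \<in> P" using \<open>S \<subseteq> P\<close> by blast
    then show "c p * (u p + v p - 1) \<le> c p * (u p * v p)"
      by (intro mult_left_mono binary_sum_minus_one_le_product c u v)
  qed
  also have "\<dots> \<le> (\<Sum>p\<in>P. c p * (u p * v p))"
    using \<open>finite P\<close> \<open>S \<subseteq> P\<close> nonneg by (intro sum_mono2) auto
  finally have "d * (\<Sum>p\<in>S. c p * (u p + v p - 1)) \<le> d * (\<Sum>p\<in>P. c p * (u p * v p))"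
    using \<open>0 \<le> d\<close> by (rule mult_left_mono)
  with bilinear show "d * (\<Sum>p\<in>S. c p * (u p + v p - 1)) \<le> b"
    by linarith
next
  assume linear: "\<forall>S \<subseteq> P. d * (\<Sum>p\<in>S. c p * (u p + v p - 1)) \<le> b"
  define T where "T = {p \<in> P. u p = 1 \<and> v p = 1}"
  have "T \<subseteq> P" by (auto simp: T_def)
  have "(\<Sum>p\<in>T. c p * (u p + v p - 1)) = (\<Sum>p\<in>T. c p * (u p * v p))"
    by (rule sum.cong) (auto simp: T_def)
  also have "\<dots> = (\<Sum>p\<in>P. c p * (u p * v p))"
    using \<open>finite P\<close> \<open>T \<subseteq> P\<close> u v by (intro sum.mono_neutral_left) (auto simp: T_def)
  finally show "d * (\<Sum>p\<in>P. c p * (u p * v p)) \<le> b"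
    using linear \<open>T \<subseteq> P\<close> by metis
qed

theorem proposition3p2:
  fixes n :: nat
    and N :: "nat set"
    and E :: "nat set set"
    and w :: "nat \<Rightarrow> nat \<Rightarrow> real"
    and dH :: "real ^ 'd \<Rightarrow> real ^ 'd \<Rightarrow> real"
    and z :: "nat \<Rightarrow> nat \<Rightarrow> real"
    and \<mu> :: "nat \<Rightarrow> nat \<Rightarrow> real"
    and x :: "nat \<Rightarrow> real ^ 'd"
  assumes "N = {1..n}"
    and "undirected_graph N E"
    and "\<And>i j. i \<in> N \<Longrightarrow> j \<in> N \<Longrightarrow> 0 \<le> w i j"
    and "\<And>a b. 0 \<le> dH a b"
    and "\<And>i k. {i, k} \<in> E \<Longrightarrow> z i k \<in> {0, 1}"
    and "\<And>k m. {k, m} \<in> E \<Longrightarrow> 0 \<le> \<mu> k m"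
  shows
    "(\<forall>k m. {k, m} \<in> E \<longrightarrow>
        \<mu> k m \<ge> (\<Sum>(i, j)\<in>allocation_pairs N E k m. w i j * dH (x k) (x m) * z i k * z j m))
     \<longleftrightarrow>
     (\<forall>k m. {k, m} \<in> E \<longrightarrow>
        (\<forall>S \<subseteq> allocation_pairs N E k m.
           \<mu> k m \<ge> dH (x k) (x m) * (\<Sum>(i, j)\<in>S. w i j * (z i k + z j m - 1))))"
proof -
  have arc: "(\<Sum>(i, j)\<in>allocation_pairs N E k m. w i j * dH (x k) (x m) * z i k * z j m) \<le> \<mu> k m
    \<longleftrightarrow> (\<forall>S \<subseteq> allocation_pairs N E k m.
          dH (x k) (x m) * (\<Sum>(i, j)\<in>S. w i j * (z i k + z j m - 1)) \<le> \<mu> k m)" for k m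
  proof -
    let ?P = "allocation_pairs N E k m"
    have "?P \<subseteq> N \<times> N" by (auto simp: allocation_pairs_def)
    then have "finite ?P"
      using \<open>N = {1..n}\<close> by (auto intro: finite_subset)
    have "(\<Sum>(i, j)\<in>?P. w i j * dH (x k) (x m) * z i k * z j m)
        = dH (x k) (x m) * (\<Sum>p\<in>?P. w (fst p) (snd p) * (z (fst p) k * z (snd p) m))"
      by (simp add: sum_distrib_left case_prod_unfold mult_ac)
    moreover have "dH (x k) (x m) * (\<Sum>p\<in>?P. w (fst p) (snd p) * (z (fst p) k * z (snd p) m)) \<le> \<mu> k m
      \<longleftrightarrow> (\<forall>S \<subseteq> ?P. dH (x k) (x m)
            * (\<Sum>p\<in>S. w (fst p) (snd p) * (z (fst p) k + z (snd p) m - 1)) \<le> \<mu> k m)"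
      using \<open>finite ?P\<close> assms(4)
    proof (rule bilinear_bound_iff_subset_bounds)
      fix p
      assume "p \<in> ?P"
      then have p: "fst p \<in> N" "snd p \<in> N" "{fst p, k} \<in> E" "{snd p, m} \<in> E"
        by (auto simp: allocation_pairs_def)
      show "0 \<le> w (fst p) (snd p)" using assms(3) p by blast
      show "z (fst p) k \<in> {0, 1}" using assms(5) p by blast
      show "z (snd p) m \<in> {0, 1}" using assms(5) p by blast
    qed
    ultimately show ?thesis
      by (simp add: case_prod_unfold)
  qed
  show ?thesis
    by (simp only: arc)
qed

end
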